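(* Let $a_t, c_t\geqslant 0$ be continuously differentiable functions of time $t\geqslant 0$. For a differentiable convex function $f:\mathbf{R}^d\to\mathbf{R}$ with a minimizer $x_\star$ and $f_\star=f(x_\star)$, and for a trajectory $X_t$, put $$\mathcal{V}_{a_t,c_t}(X_t,t)=a_t\,(f(X_t)-f_\star)+c_t\,\|X_t-x_\star\|^2 .$$ The following assertions are equivalent: (i) The inequality $\frac{d}{dt}\mathcal{V}_{a_t,c_t}(X_t,t)\leqslant 0$ is satisfied (for all $t\geqslant 0$) for every dimension $d\in\mathbf{N}$, every $f\in\mathcal{F}_{0,\infty}$ on $\mathbf{R}^d$ having a minimizer $x_\star$, and every trajectory $X_t$ generated by the gradient flow $\dot X_t=-\nabla f(X_t)$, $X_0=x_0\in\mathbf{R}^d$. (ii) For all $t\geqslant 0$ there exist $\lambda^{(1)}_t,\lambda^{(2)}_t\geqslant 0$ such that $$\begin{pmatrix}\dot c_t & -c_t+\frac{\lambda^{(1)}_t}{2}\\ -c_t+\frac{\lambda^{(1)}_t}{2} & -a_t\end{pmatrix}\preccurlyeq 0,\qquad \dot a_t=\lambda^{(1)}_t-\lambda^{(2)}_t .$$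
   Context: $\mathcal{F}_{0,\infty}$ denotes the family of differentiable convex functions $f:\mathbf{R}^d\to\mathbf{R}$; functions are assumed to have a minimizer $x_\star$. A dot denotes the derivative with respect to $t$. The notation $M\preccurlyeq 0$ means that the symmetric matrix $M$ is negative semidefinite. *)

theory Defs
  imports "HOL-Analysis.Analysis"
begin

text \<open>
  The dimension \<open>d\<close> is quantified inside the theorem, so it cannot be a type index.
  Vectors of \<open>\<real>\<^sup>d\<close> are therefore the points of the library space \<^const>\<open>Euclidean_space\<close> \<open>d\<close>,
  i.e. sequences \<open>x :: nat \<Rightarrow> real\<close> with \<open>x i = 0\<close> for all \<open>i \<ge> d\<close>.
  A function \<open>f : \<real>\<^sup>d \<rightarrow> \<real>\<close> is given by its values on this carrier only.
\<close>

abbreviation Rn :: "nat \<Rightarrow> (nat \<Rightarrow> real) set"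
  where "Rn d \<equiv> topspace (Euclidean_space d)"

definition euclid_inner :: "nat \<Rightarrow> (nat \<Rightarrow> real) \<Rightarrow> (nat \<Rightarrow> real) \<Rightarrow> real"
  where "euclid_inner d x y = (\<Sum>i<d. x i * y i)"

definition euclid_dist :: "nat \<Rightarrow> (nat \<Rightarrow> real) \<Rightarrow> (nat \<Rightarrow> real) \<Rightarrow> real"
  where "euclid_dist d x y = L2_set (\<lambda>i. x i - y i) {..<d}"

text \<open>
  \<open>g = \<nabla>f(x)\<close> in the sense of Frechet, relative to \<open>\<real>\<^sup>d\<close>:
  \<open>f y = f x + \<langle>g, y - x\<rangle> + o(\<parallel>y - x\<parallel>)\<close> as \<open>y \<rightarrow> x\<close> in \<open>\<real>\<^sup>d\<close>.
\<close>

definition has_gradient ::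
    "nat \<Rightarrow> ((nat \<Rightarrow> real) \<Rightarrow> real) \<Rightarrow> (nat \<Rightarrow> real) \<Rightarrow> (nat \<Rightarrow> real) \<Rightarrow> bool"
  where "has_gradient d f g x \<longleftrightarrow>
    g \<in> Rn d \<and>
    (\<forall>e>0. \<exists>\<delta>>0. \<forall>y\<in>Rn d. euclid_dist d y x < \<delta> \<longrightarrow>
       \<bar>f y - f x - euclid_inner d g (\<lambda>i. y i - x i)\<bar> \<le> e * euclid_dist d y x)"

definition differentiable_Rn :: "nat \<Rightarrow> ((nat \<Rightarrow> real) \<Rightarrow> real) \<Rightarrow> bool"
  where "differentiable_Rn d f \<longleftrightarrow> (\<forall>x\<in>Rn d. \<exists>g. has_gradient d f g x)"

definition convex_Rn :: "nat \<Rightarrow> ((nat \<Rightarrow> real) \<Rightarrow> real) \<Rightarrow> bool"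
  where "convex_Rn d f \<longleftrightarrow>
    (\<forall>x\<in>Rn d. \<forall>y\<in>Rn d. \<forall>u\<in>{0..1}.
       f (\<lambda>i. (1 - u) * x i + u * y i) \<le> (1 - u) * f x + u * f y)"

definition F_0_inf :: "nat \<Rightarrow> ((nat \<Rightarrow> real) \<Rightarrow> real) set"
  where "F_0_inf d = {f. differentiable_Rn d f \<and> convex_Rn d f}"

definition is_minimizer :: "nat \<Rightarrow> ((nat \<Rightarrow> real) \<Rightarrow> real) \<Rightarrow> (nat \<Rightarrow> real) \<Rightarrow> bool"
  where "is_minimizer d f xs \<longleftrightarrow> xs \<in> Rn d \<and> (\<forall>x\<in>Rn d. f xs \<le> f x)"

text \<open>
  \<open>X\<close> solves \<open>X' = -\<nabla>f(X)\<close>, \<open>X 0 = x0\<close> on \<open>[0, \<infinity>)\<close>. Derivatives in time are taken within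
  \<open>{0..}\<close>, so they are one-sided at \<open>0\<close>, and values of \<open>X\<close> at negative times are irrelevant.
\<close>

definition gradient_flow ::
    "nat \<Rightarrow> ((nat \<Rightarrow> real) \<Rightarrow> real) \<Rightarrow> (nat \<Rightarrow> real) \<Rightarrow> (real \<Rightarrow> nat \<Rightarrow> real) \<Rightarrow> bool"
  where "gradient_flow d f x0 X \<longleftrightarrow>
    X 0 = x0 \<and>
    (\<forall>t\<ge>0. X t \<in> Rn d \<and>
       (\<exists>g. has_gradient d f g (X t) \<and>
          (\<forall>i<d. ((\<lambda>s. X s i) has_real_derivative - g i) (at t within {0..}))))"

definition lyap ::
    "nat \<Rightarrow> ((nat \<Rightarrow> real) \<Rightarrow> real) \<Rightarrow> (nat \<Rightarrow> real) \<Rightarrow> real \<Rightarrow> real \<Rightarrow> (nat \<Rightarrow> real) \<Rightarrow> real"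
  where "lyap d f xs \<alpha> \<gamma> x = \<alpha> * (f x - f xs) + \<gamma> * (euclid_dist d x xs)\<^sup>2"

definition neg_semidef :: "real ^ 'n ^ 'n \<Rightarrow> bool"
  where "neg_semidef M \<longleftrightarrow> transpose M = M \<and> (\<forall>v. v \<bullet> (M *v v) \<le> 0)"

end

theory Submission
  imports Defs
begin

text \<open>
  Write \<open>x = X\<^sub>t - x\<^sub>\<star>\<close>, \<open>g = \<nabla>f(X\<^sub>t)\<close> and \<open>F = f(X\<^sub>t) - f\<^sub>\<star>\<close>. Along the flow the Lyapunov function has derivative
  \<open>a' F - a \<parallel>g\<parallel>\<^sup>2 + c' \<parallel>x\<parallel>\<^sup>2 - 2 c \<langle>x, g\<rangle>\<close>. Convexity gives \<open>0 \<le> F \<le> \<langle>x, g\<rangle>\<close>, and \<open>l1\<close>, \<open>l2\<close> are the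
  multipliers of these two inequalities.

  Conversely, the flow of \<open>f = 0\<close> forces \<open>c' \<le> 0\<close>, so that \<open>l1 = 2 c\<close> works if \<open>a' \<le> 2 c\<close>. If \<open>a' > 2 c\<close>
  take \<open>l1 = a'\<close>, \<open>l2 = 0\<close>: the quadratic form is nonpositive at \<open>(x, g)\<close> trivially if \<open>x g \<le> 0\<close>,
  and otherwise because of the functions \<open>f y = g \<delta> ln (cosh (y / \<delta>))\<close>, which tend to \<open>g \<bar>y\<bar>\<close> as
  \<open>\<delta> \<rightarrow> 0\<close> and whose flow is explicit, so that it can be made to pass through \<open>x\<close> at any given time.
\<close>

section \<open>Gradient calculus along curves and segments\<close>

lemma euclid_dist_power2: "(euclid_dist d x y)\<^sup>2 = (\<Sum>i<d. (x i - y i)\<^sup>2)"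
  by (simp add: euclid_dist_def L2_set_def sum_nonneg)

lemma Rn_iff: "x \<in> Rn d \<longleftrightarrow> (\<forall>i\<ge>d. x i = 0)"
  by (simp add: topspace_Euclidean_space)

text \<open>Divided by \<open>s - t\<close>, the gradient estimate compares the difference quotient
  of \<open>f\<close> along \<open>X\<close> with the inner product of \<open>g\<close> and the
  difference quotient \<open>w s\<close>. The error is an arbitrarily small multiple of the norm of
  \<open>w s\<close>, which stays bounded because it converges to the norm of
  \<open>v\<close>.\<close>

lemma has_gradient_chain:
  assumes grad: "has_gradient d f g (X t)"
    and X_Rn: "\<And>s. s \<in> S \<Longrightarrow> X s \<in> Rn d"
    and deriv: "\<And>i. i < d \<Longrightarrow> ((\<lambda>s. X s i) has_real_derivative v i) (at t within S)"
  shows "((\<lambda>s. f (X s)) has_real_derivative euclid_inner d g v) (at t within S)"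
proof -
  define w where "w s i = (X s i - X t i) / (s - t)" for s i
  have w: "((\<lambda>s. w s i) \<longlongrightarrow> v i) (at t within S)" if "i < d" for i
    using deriv[OF that] by (simp add: has_field_derivative_iff w_def)
  have X: "((\<lambda>s. X s i) \<longlongrightarrow> X t i) (at t within S)" if "i < d" for i
    using DERIV_continuous[OF deriv[OF that]] by (simp add: continuous_within)
  have R: "((\<lambda>s. L2_set (w s) {..<d}) \<longlongrightarrow> L2_set v {..<d}) (at t within S)"
    unfolding L2_set_def by (intro tendsto_intros w) auto
  have "((\<lambda>s. euclid_dist d (X s) (X t)) \<longlongrightarrow> L2_set (\<lambda>i. X t i - X t i) {..<d}) (at t within S)"
    unfolding euclid_dist_def L2_set_def by (intro tendsto_intros X) auto
  then have dist0: "((\<lambda>s. euclid_dist d (X s) (X t)) \<longlongrightarrow> 0) (at t within S)"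
    by (simp add: L2_set_def)
  have inner: "((\<lambda>s. euclid_inner d g (w s)) \<longlongrightarrow> euclid_inner d g v) (at t within S)"
    unfolding euclid_inner_def by (intro tendsto_intros w) auto
  have "((\<lambda>s. (f (X s) - f (X t)) / (s - t) - euclid_inner d g (w s)) \<longlongrightarrow> 0) (at t within S)"
  proof (rule tendstoI)
    fix e :: real assume e: "e > 0"
    \<comment> \<open>A strict bound on the limit of the norm of \<open>w s\<close>, positive even
      if \<open>v\<close> vanishes; the gradient estimate is used with \<open>e / L\<close> to end
      below \<open>e\<close>.\<close>
    define L where "L = L2_set v {..<d} + 1"
    have L: "L > 0"
      by (simp add: L_def add_nonneg_pos L2_set_nonneg)
    obtain \<delta> where \<delta>: "\<delta> > 0" and le: "\<And>y. y \<in> Rn d \<Longrightarrow> euclid_dist d y (X t) < \<delta> \<Longrightarrow>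
        \<bar>f y - f (X t) - euclid_inner d g (\<lambda>i. y i - X t i)\<bar> \<le> e / L * euclid_dist d y (X t)"
      using grad[unfolded has_gradient_def, THEN conjunct2, rule_format, OF divide_pos_pos[OF e L]]
      by blast
    have "\<forall>\<^sub>F s in at t within S. L2_set (w s) {..<d} < L"
      using order_tendstoD(2)[OF R, of L] by (simp add: L_def)
    moreover have "\<forall>\<^sub>F s in at t within S. euclid_dist d (X s) (X t) < \<delta>"
      using order_tendstoD(2)[OF dist0 \<delta>] .
    moreover have "\<forall>\<^sub>F s in at t within S. s \<in> S \<and> s \<noteq> t"
      by (simp add: eventually_at_filter)
    ultimately show "\<forall>\<^sub>F s in at t within S.
        dist ((f (X s) - f (X t)) / (s - t) - euclid_inner d g (w s)) 0 < e"
    proof eventually_elim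
      case (elim s)
      then have st: "\<bar>s - t\<bar> > 0"
        by simp
      have dist_w: "euclid_dist d (X s) (X t) = \<bar>s - t\<bar> * L2_set (w s) {..<d}"
        using elim by (subst L2_set_right_distrib)
          (auto simp: euclid_dist_def L2_set_def w_def power_mult_distrib power_divide)
      have inner_w: "euclid_inner d g (\<lambda>i. X s i - X t i) = (s - t) * euclid_inner d g (w s)"
        using elim by (simp add: euclid_inner_def sum_distrib_left w_def)
      have "\<bar>s - t\<bar> * \<bar>(f (X s) - f (X t)) / (s - t) - euclid_inner d g (w s)\<bar>
          = \<bar>f (X s) - f (X t) - euclid_inner d g (\<lambda>i. X s i - X t i)\<bar>"
        unfolding abs_mult[symmetric] inner_w right_diff_distrib using elim by simp
      also have "\<dots> \<le> e / L * euclid_dist d (X s) (X t)"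
        using elim by (intro le X_Rn) auto
      also have "\<dots> = \<bar>s - t\<bar> * (e / L * L2_set (w s) {..<d})"
        by (simp add: dist_w)
      also have "\<dots> < \<bar>s - t\<bar> * (e / L * L)"
        using elim st e L by (intro mult_strict_left_mono) auto
      finally show ?case
        using st L by simp
    qed
  qed
  from tendsto_add[OF this inner] show ?thesis
    by (simp add: has_field_derivative_iff)
qed

text \<open>By convexity the difference quotients of \<open>f\<close> on the segment from
  \<open>x\<close> to \<open>y\<close> are at most \<open>f y - f x\<close>; as the parameter tends
  to 0, so is their limit, the directional derivative.\<close>

lemma has_gradient_convex_le:
  assumes conv: "convex_Rn d f" and grad: "has_gradient d f g x"
    and x: "x \<in> Rn d" and y: "y \<in> Rn d"
  shows "f x + euclid_inner d g (\<lambda>i. y i - x i) \<le> f y"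
proof -
  define Z where "Z s i = (1 - s) * x i + s * y i" for s i
  have Z0: "Z 0 = x"
    by (simp add: Z_def fun_eq_iff)
  have "((\<lambda>s. f (Z s)) has_real_derivative euclid_inner d g (\<lambda>i. y i - x i)) (at 0 within {0..1})"
  proof (rule has_gradient_chain[where f = f and X = Z])
    show "has_gradient d f g (Z 0)"
      using grad by (simp add: Z0)
    show "Z s \<in> Rn d" for s
      using x y by (simp add: Rn_iff Z_def)
    show "((\<lambda>s. Z s i) has_real_derivative y i - x i) (at 0 within {0..1})" for i
      unfolding Z_def by (auto intro!: derivative_eq_intros)
  qed
  then have lim: "((\<lambda>s. (f (Z s) - f x) / s) \<longlongrightarrow> euclid_inner d g (\<lambda>i. y i - x i)) (at 0 within {0..1})"
    by (simp add: has_field_derivative_iff Z0)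
  have ntriv: "at 0 within {0..1::real} \<noteq> bot"
    by (simp add: trivial_limit_within islimpt_Icc)
  have "\<forall>\<^sub>F s in at 0 within {0..1}. s \<in> {0..1} \<and> s \<noteq> (0::real)"
    by (simp add: eventually_at_filter)
  then have "\<forall>\<^sub>F s in at 0 within {0..1}. (f (Z s) - f x) / s \<le> f y - f x"
  proof eventually_elim
    case (elim s)
    then have "f (Z s) \<le> (1 - s) * f x + s * f y"
      using conv x y unfolding convex_Rn_def Z_def by blast
    with elim show ?case
      by (simp add: field_simps)
  qed
  from tendsto_upperbound[OF lim this ntriv] show ?thesis
    by simp
qed

text \<open>Product rule and chain rule. The terms in \<open>x\<close> and \<open>g\<close> are
  gathered into one sum over coordinates, so that a form in two real variables can later be applied
  to each summand.\<close>

lemma lyap_flow_derivative: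
  assumes grad: "has_gradient d f g (X t)"
    and X_Rn: "\<And>s. s \<in> S \<Longrightarrow> X s \<in> Rn d"
    and deriv: "\<And>i. i < d \<Longrightarrow> ((\<lambda>s. X s i) has_real_derivative - g i) (at t within S)"
    and a: "(a has_real_derivative a') (at t within S)"
    and c: "(c has_real_derivative c') (at t within S)"
  shows "((\<lambda>s. lyap d f xs (a s) (c s) (X s)) has_real_derivative
      a' * (f (X t) - f xs) + (\<Sum>i<d. c' * (X t i - xs i)\<^sup>2
        - 2 * c t * ((X t i - xs i) * g i) - a t * (g i)\<^sup>2)) (at t within S)"
proof -
  have f: "((\<lambda>s. f (X s)) has_real_derivative euclid_inner d g (\<lambda>i. - g i)) (at t within S)"
    using grad X_Rn deriv by (rule has_gradient_chain)
  have sq: "((\<lambda>s. \<Sum>i<d. (X s i - xs i)\<^sup>2) has_real_derivative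
      - 2 * (\<Sum>i<d. (X t i - xs i) * g i)) (at t within S)"
    unfolding sum_distrib_left by (intro DERIV_sum) (auto intro!: derivative_eq_intros deriv)
  have sums: "euclid_inner d g (\<lambda>i. - g i) = - (\<Sum>i<d. (g i)\<^sup>2)"
    "(\<Sum>i<d. c' * (X t i - xs i)\<^sup>2 - 2 * c t * ((X t i - xs i) * g i) - a t * (g i)\<^sup>2)
      = c' * (\<Sum>i<d. (X t i - xs i)\<^sup>2) - 2 * c t * (\<Sum>i<d. (X t i - xs i) * g i)
        - a t * (\<Sum>i<d. (g i)\<^sup>2)"
    by (simp_all only: sum_subtractf sum_distrib_left[symmetric])
      (simp add: euclid_inner_def sum_negf power2_eq_square)
  show ?thesis
    unfolding lyap_def euclid_dist_power2
    by (rule DERIV_cong[OF DERIV_add[OF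
            DERIV_mult[OF a DERIV_diff[OF f DERIV_const]] DERIV_mult[OF c sq]]])
      (simp add: sums)
qed

section \<open>Semidefiniteness of a symmetric 2x2 matrix as a form in two variables\<close>

lemma neg_semidef_2_iff:
  "neg_semidef (vector [vector [p, q], vector [q, r]] :: real^2^2) \<longleftrightarrow>
    (\<forall>x y. p * x\<^sup>2 + 2 * q * (x * y) + r * y\<^sup>2 \<le> 0)"
    (is "neg_semidef ?M \<longleftrightarrow> ?R")
proof -
  have "transpose ?M = ?M"
    by (simp add: vec_eq_iff transpose_def forall_2)
  moreover have form: "v \<bullet> (?M *v v) = p * (v $ 1)\<^sup>2 + 2 * q * (v $ 1 * v $ 2) + r * (v $ 2)\<^sup>2" for v
    by (simp add: inner_vec_def matrix_vector_mult_def sum_2 power2_eq_square algebra_simps)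
  moreover have "(\<forall>v::real^2. p * (v $ 1)\<^sup>2 + 2 * q * (v $ 1 * v $ 2) + r * (v $ 2)\<^sup>2 \<le> 0) \<longleftrightarrow> ?R"
  proof (intro iffI allI)
    fix x y
    assume "\<forall>v::real^2. p * (v $ 1)\<^sup>2 + 2 * q * (v $ 1 * v $ 2) + r * (v $ 2)\<^sup>2 \<le> 0"
    from this[THEN spec, of "vector [x, y]"] show "p * x\<^sup>2 + 2 * q * (x * y) + r * y\<^sup>2 \<le> 0"
      by simp
  qed blast
  ultimately show ?thesis
    unfolding neg_semidef_def by (simp only: form simp_thms)
qed

section \<open>One-dimensional test functions and their explicit flows\<close>

lemma has_gradient_1:
  assumes "(h has_real_derivative D) (at (x 0))"
  shows "has_gradient 1 (\<lambda>x. h (x 0)) (\<lambda>i. if i = 0 then D else 0) x"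
proof -
  have "\<forall>e>0. \<exists>\<delta>>0. \<forall>y. \<bar>y - x 0\<bar> < \<delta> \<longrightarrow> \<bar>h y - h (x 0) - D * (y - x 0)\<bar> \<le> e * \<bar>y - x 0\<bar>"
    using assms by (simp add: has_field_derivative_def has_derivative_at_alt)
  then show ?thesis
    unfolding has_gradient_def
    by (simp add: Rn_iff euclid_dist_def euclid_inner_def L2_set_def) meson
qed

lemma convex_Rn_1:
  assumes "convex_on UNIV h"
  shows "convex_Rn 1 (\<lambda>x. h (x 0))"
  using convex_onD[OF assms] by (auto simp: convex_Rn_def)

text \<open>Makes derivatives within \<open>{b..}\<close> unique, also the one-sided derivative at
  \<open>b\<close>.\<close>

lemma at_within_Ici_neq_bot:
  assumes "t \<ge> b"
  shows "at t within {b..} \<noteq> (bot :: real filter)"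
proof -
  have "at t within {t..t + 1} \<noteq> bot"
    by (simp add: trivial_limit_within islimpt_Icc)
  moreover have "at t within {t..t + 1} \<le> at t within {b..}"
    using assms by (intro at_le) auto
  ultimately show ?thesis
    by (auto dest: bot.extremum_uniqueI)
qed

text \<open>Assertion (i), named so that it can be passed around as a single hypothesis.\<close>

definition lyapunov_decreasing where
  "lyapunov_decreasing a c \<longleftrightarrow>
    (\<forall>d::nat. \<forall>f\<in>F_0_inf d. \<forall>xs. is_minimizer d f xs \<longrightarrow>
      (\<forall>x0\<in>Rn d. \<forall>X. gradient_flow d f x0 X \<longrightarrow>
        (\<forall>t\<ge>0. \<exists>D. ((\<lambda>s. lyap d f xs (a s) (c s) (X s)) has_real_derivative D)
                      (at t within {0..}) \<and> D \<le> 0)))"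

text \<open>Tests the hypothesis in dimension 1 with minimizer 0. A monotone \<open>h'\<close> makes
  \<open>h\<close> convex, and uniqueness of derivatives identifies the unspecified \<open>D\<close>
  with the computed derivative.\<close>

lemma lyapunov_decreasing_1D:
  assumes dec: "lyapunov_decreasing a c"
    and h: "\<And>y. (h has_real_derivative h' y) (at y)"
    and mono: "mono h'"
    and min: "\<And>y. h 0 \<le> h y"
    and Y: "\<And>s. s \<ge> 0 \<Longrightarrow> (Y has_real_derivative - h' (Y s)) (at s within {0..})"
    and t: "t \<ge> 0"
    and a: "(a has_real_derivative a') (at t within {0..})"
    and c: "(c has_real_derivative c') (at t within {0..})"
  shows "a' * (h (Y t) - h 0) + c' * (Y t)\<^sup>2 - 2 * c t * (Y t * h' (Y t)) - a t * (h' (Y t))\<^sup>2 \<le> 0"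
proof -
  define f where "f x = h (x 0)" for x :: "nat \<Rightarrow> real"
  \<comment> \<open>The zero coordinates place points and gradients in \<open>Rn 1\<close>.\<close>
  define X where "X s i = (if i = 0 then Y s else 0)" for s and i :: nat
  define G where "G y i = (if i = 0 then h' y else 0)" for y and i :: nat
  have grad: "has_gradient 1 f (G (x 0)) x" for x
    unfolding f_def G_def by (rule has_gradient_1) (rule h)
  have "convex_on UNIV h"
    using h mono by (intro convex_on_realI[where f' = h']) (auto simp: mono_def)
  then have F: "f \<in> F_0_inf 1"
    using grad convex_Rn_1[of h] by (auto simp: F_0_inf_def differentiable_Rn_def f_def[abs_def])
  have min_f: "is_minimizer 1 f (\<lambda>_. 0)"
    using min by (simp add: is_minimizer_def Rn_iff f_def)
  have X_Rn: "X s \<in> Rn 1" for s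
    by (simp add: Rn_iff X_def)
  have grad_X: "has_gradient 1 f (G (Y s)) (X s)" for s
    using grad[of "X s"] by (simp add: X_def)
  have deriv: "((\<lambda>s. X s i) has_real_derivative - G (Y s) i) (at s within {0..})"
    if "s \<ge> 0" "i < 1" for s i
    using Y that by (simp add: X_def G_def)
  have flow: "gradient_flow 1 f (X 0) X"
    unfolding gradient_flow_def using X_Rn grad_X deriv by blast
  obtain D where D: "((\<lambda>s. lyap 1 f (\<lambda>_. 0) (a s) (c s) (X s)) has_real_derivative D)
      (at t within {0..})" "D \<le> 0"
    using dec[unfolded lyapunov_decreasing_def, rule_format, OF F min_f X_Rn flow t] by blast
  have "D = a' * (f (X t) - f (\<lambda>_. 0)) + (\<Sum>i<1. c' * (X t i - 0)\<^sup>2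
        - 2 * c t * ((X t i - 0) * G (Y t) i) - a t * (G (Y t) i)\<^sup>2)"
    by (rule has_field_derivative_unique[OF D(1)
          lyap_flow_derivative[OF grad_X X_Rn deriv[OF t] a c] at_within_Ici_neq_bot[OF t]])
  with D(2) show ?thesis
    by (simp add: X_def G_def f_def)
qed

text \<open>After scaling, this bounds how far \<open>\<delta> * ln (cosh (y / \<delta>))\<close>
  can fall below \<open>y\<close>: by at most \<open>\<delta> * ln 2\<close>.\<close>

lemma le_ln_cosh: "x - ln 2 \<le> ln (cosh (x::real))"
proof -
  have "exp x / 2 \<le> cosh x"
    by (simp add: cosh_field_def)
  then have "ln (exp x / 2) \<le> ln (cosh x)"
    by (intro ln_mono) auto
  then show ?thesis
    by (simp add: ln_div)
qed

text \<open>The substitution \<open>u = sinh (Y / \<delta>)\<close> turns the flow equation into the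
  linear equation \<open>u' = - (g / \<delta>) * u\<close>, whose solution with
  \<open>u 0 = z\<close> is exponential.\<close>

lemma tanh_flow:
  fixes g \<delta> z :: real
  assumes "\<delta> > 0"
  defines "Y \<equiv> \<lambda>s. \<delta> * arsinh (z * exp (- g * s / \<delta>))"
  shows "(Y has_real_derivative - (g * tanh (Y s / \<delta>))) (at s within S)"
  unfolding Y_def using assms(1)
  by (auto intro!: derivative_eq_intros DERIV_chain2[OF arsinh_real_has_field_derivative]
      simp: tanh_def cosh_arsinh_real)

text \<open>The smoothed absolute value \<open>h\<close> with slope bound \<open>g\<close> is tested
  at the moment its flow passes through \<open>x\<close>. Replacing \<open>h x\<close> by
  \<open>g * x\<close> costs at most \<open>a' * g * ln 2 * \<delta>\<close>, which is made at most
  \<open>e\<close>.\<close>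

lemma lyapunov_decreasing_pos_form:
  assumes dec: "lyapunov_decreasing a c"
    and t: "t \<ge> 0"
    and a: "(a has_real_derivative a') (at t within {0..})"
    and c: "(c has_real_derivative c') (at t within {0..})"
    and nonneg: "a t \<ge> 0" "c t \<ge> 0" "a' \<ge> 0"
    and x: "x > 0" and g: "g > 0"
  shows "c' * x\<^sup>2 + (a' - 2 * c t) * (x * g) - a t * g\<^sup>2 \<le> 0"
proof (rule field_le_epsilon)
  fix e :: real assume e: "e > 0"
  \<comment> \<open>The summand 1 keeps the denominator positive if \<open>a' = 0\<close>.\<close>
  define \<delta> where "\<delta> = e / (a' * g * ln 2 + 1)"
  have pos: "a' * g * ln 2 + 1 > 0"
    using nonneg g by (intro add_nonneg_pos mult_nonneg_nonneg) auto
  have \<delta>: "\<delta> > 0"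
    using e pos by (simp add: \<delta>_def)
  have small: "a' * g * ln 2 * \<delta> \<le> e"
    using e pos by (simp add: \<delta>_def field_simps)
  define h where "h y = g * \<delta> * ln (cosh (y / \<delta>))" for y
  \<comment> \<open>The initial value of \<open>sinh (Y / \<delta>)\<close> is
    \<open>sinh (x / \<delta>)\<close> carried backwards from time \<open>t\<close>, hence
    \<open>Y t = x\<close>.\<close>
  define Y where "Y s = \<delta> * arsinh (sinh (x / \<delta>) * exp (g * t / \<delta>) * exp (- g * s / \<delta>))" for s
  define T where "T = tanh (x / \<delta>)"
  have Yt: "Y t = x"
    using \<delta> by (simp add: Y_def mult.assoc arsinh_sinh_real flip: exp_add)
  have T: "0 \<le> T" "T \<le> 1"
    using x \<delta> tanh_real_lt_1[of "x / \<delta>"] by (auto simp: T_def)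
  have "a' * (h (Y t) - h 0) + c' * (Y t)\<^sup>2 - 2 * c t * (Y t * (g * tanh (Y t / \<delta>)))
      - a t * (g * tanh (Y t / \<delta>))\<^sup>2 \<le> 0"
  proof (rule lyapunov_decreasing_1D[OF dec _ _ _ _ t a c])
    show "(h has_real_derivative g * tanh (y / \<delta>)) (at y)" for y
      unfolding h_def using \<delta> cosh_real_pos[of "y / \<delta>"]
      by (auto intro!: derivative_eq_intros simp: tanh_def)
    show "mono (\<lambda>y. g * tanh (y / \<delta>))"
      using g \<delta> by (auto intro!: monoI mult_left_mono simp: divide_right_mono)
    show "h 0 \<le> h y" for y
      using g \<delta> cosh_real_ge_1[of "y / \<delta>"] by (simp add: h_def)
    show "(Y has_real_derivative - (g * tanh (Y s / \<delta>))) (at s within {0..})" for s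
      unfolding Y_def by (rule tanh_flow[OF \<delta>])
  qed
  then have 1: "a' * h x + c' * x\<^sup>2 - 2 * c t * (x * (g * T)) - a t * (g * T)\<^sup>2 \<le> 0"
    by (simp add: Yt T_def h_def)
  have "g * \<delta> * (x / \<delta> - ln 2) \<le> h x"
    unfolding h_def using g \<delta> by (intro mult_left_mono le_ln_cosh) auto
  then have "a' * (g * x - g * ln 2 * \<delta>) \<le> a' * h x"
    using \<delta> nonneg by (intro mult_left_mono) (simp_all add: algebra_simps)
  \<comment> \<open>The true slope at \<open>x\<close> is \<open>g * T\<close> with
    \<open>T \<le> 1\<close>. It occurs only in terms that are subtracted, so enlarging it to
    \<open>g\<close> preserves the inequality.\<close>
  moreover have "2 * c t * (x * (g * T)) \<le> 2 * c t * (x * g)"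
    using nonneg x g T by (intro mult_left_mono) (simp_all add: mult_left_le)
  moreover have "a t * (g * T)\<^sup>2 \<le> a t * g\<^sup>2"
    using nonneg g T by (intro mult_left_mono power_mono) (simp_all add: mult_left_le)
  ultimately show "c' * x\<^sup>2 + (a' - 2 * c t) * (x * g) - a t * g\<^sup>2 \<le> 0 + e"
    using 1 small by (simp add: algebra_simps)
qed

text \<open>The form is unchanged when both variables change sign, so the case
  \<open>x * y > 0\<close> reduces to positive arguments; otherwise each term is nonpositive by
  itself.\<close>

lemma quadratic_form_nonpos:
  fixes p q r :: real
  assumes pos: "\<And>x y. x > 0 \<Longrightarrow> y > 0 \<Longrightarrow> p * x\<^sup>2 + q * (x * y) - r * y\<^sup>2 \<le> 0"
    and "p \<le> 0" "q \<ge> 0" "r \<ge> 0"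
  shows "p * x\<^sup>2 + q * (x * y) - r * y\<^sup>2 \<le> 0"
proof (cases "x * y > 0")
  case True
  then have "p * \<bar>x\<bar>\<^sup>2 + q * (\<bar>x\<bar> * \<bar>y\<bar>) - r * \<bar>y\<bar>\<^sup>2 \<le> 0"
    by (intro pos) auto
  with True show ?thesis
    by (simp flip: abs_mult)
next
  case False
  then have "p * x\<^sup>2 \<le> 0" "q * (x * y) \<le> 0" "r * y\<^sup>2 \<ge> 0"
    using assms(2-) by (simp_all add: mult_nonpos_nonneg mult_nonneg_nonpos)
  then show ?thesis
    by linarith
qed

section \<open>The two implications at a fixed time\<close>

lemma lyapunov_decreasing_imp_multipliers:
  assumes dec: "lyapunov_decreasing a c"
    and t: "t \<ge> 0"
    and a: "(a has_real_derivative a') (at t within {0..})"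
    and c: "(c has_real_derivative c') (at t within {0..})"
    and nonneg: "a t \<ge> 0" "c t \<ge> 0"
  shows "\<exists>l1 l2 :: real. 0 \<le> l1 \<and> 0 \<le> l2 \<and>
    neg_semidef (vector [vector [c', - c t + l1 / 2], vector [- c t + l1 / 2, - a t]] :: real^2^2) \<and>
    a' = l1 - l2"
proof -
  \<comment> \<open>The zero function with the trajectory resting at 1 isolates
    \<open>c'\<close>.\<close>
  have "a' * (0 - 0) + c' * 1\<^sup>2 - 2 * c t * (1 * 0) - a t * 0\<^sup>2 \<le> 0"
    by (rule lyapunov_decreasing_1D[OF dec _ _ _ _ t a c, where h = "\<lambda>_. 0" and Y = "\<lambda>_. 1"])
      (auto simp: mono_def)
  then have c': "c' \<le> 0"
    by simp
  show ?thesis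
  proof (cases "a' \<le> 2 * c t")
    case True
    have "c' * x\<^sup>2 - a t * y\<^sup>2 \<le> 0" for x y
      using mult_nonpos_nonneg[OF c', of "x\<^sup>2"] mult_nonneg_nonneg[OF nonneg(1), of "y\<^sup>2"]
      by simp
    with True nonneg show ?thesis
      \<comment> \<open>This \<open>l1\<close> makes the matrix diagonal, and the case assumption is
        exactly \<open>0 \<le> l2\<close>.\<close>
      by (intro exI[of _ "2 * c t"] exI[of _ "2 * c t - a'"]) (simp add: neg_semidef_2_iff)
  next
    case False
    \<comment> \<open>Here \<open>a' > 2 * c t \<ge> 0\<close> provides both the sign of
      \<open>a'\<close> and that of the mixed coefficient, which is twice the off-diagonal entry for
      \<open>l1 = a'\<close>.\<close>
    with nonneg c' have "c' * x\<^sup>2 + (a' - 2 * c t) * (x * y) - a t * y\<^sup>2 \<le> 0" for x y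
      by (rule_tac quadratic_form_nonpos, rule_tac lyapunov_decreasing_pos_form[OF dec t a c]) auto
    with False nonneg show ?thesis
      by (intro exI[of _ a'] exI[of _ 0]) (simp add: neg_semidef_2_iff algebra_simps)
  qed
qed

text \<open>Weighting \<open>F \<le> \<langle>x, g\<rangle>\<close> by \<open>l1\<close> and
  \<open>0 \<le> F\<close> by \<open>l2\<close> eliminates the function values. What remains is a
  sum over coordinates of the same form in two variables, so one 2x2 matrix serves every
  dimension.\<close>

lemma multipliers_imp_derivative_nonpos:
  fixes l1 l2 :: real
  assumes f: "f \<in> F_0_inf d" and min: "is_minimizer d f xs"
    and x: "x \<in> Rn d" and grad: "has_gradient d f g x"
    and l: "0 \<le> l1" "0 \<le> l2"
    and form: "\<And>y z. c' * y\<^sup>2 + 2 * (- c + l1 / 2) * (y * z) + - a * z\<^sup>2 \<le> 0"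
  shows "(l1 - l2) * (f x - f xs) +
    (\<Sum>i<d. c' * (x i - xs i)\<^sup>2 - 2 * c * ((x i - xs i) * g i) - a * (g i)\<^sup>2) \<le> 0"
proof -
  have xs: "xs \<in> Rn d" "f xs \<le> f x"
    using min x by (auto simp: is_minimizer_def)
  have "f x + euclid_inner d g (\<lambda>i. xs i - x i) \<le> f xs"
    using f grad x xs by (intro has_gradient_convex_le) (auto simp: F_0_inf_def)
  then have "f x - f xs \<le> (\<Sum>i<d. (x i - xs i) * g i)"
    by (simp add: euclid_inner_def sum_subtractf algebra_simps)
  then have "l1 * (f x - f xs) \<le> l1 * (\<Sum>i<d. (x i - xs i) * g i)"
    using l(1) by (rule mult_left_mono)
  moreover have "0 \<le> l2 * (f x - f xs)"
    using l xs by simp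
  ultimately have "(l1 - l2) * (f x - f xs) \<le> (\<Sum>i<d. l1 * ((x i - xs i) * g i))"
    by (simp add: sum_distrib_left algebra_simps)
  \<comment> \<open>The added \<open>l1\<close> completes the mixed coefficient
    \<open>- 2 * c\<close> to twice the off-diagonal entry.\<close>
  moreover have "(\<Sum>i<d. l1 * ((x i - xs i) * g i)) +
      (\<Sum>i<d. c' * (x i - xs i)\<^sup>2 - 2 * c * ((x i - xs i) * g i) - a * (g i)\<^sup>2)
    = (\<Sum>i<d. c' * (x i - xs i)\<^sup>2 + 2 * (- c + l1 / 2) * ((x i - xs i) * g i) + - a * (g i)\<^sup>2)"
    unfolding sum.distrib[symmetric] by (intro sum.cong) (auto simp: algebra_simps)
  moreover have "\<dots> \<le> 0"
    by (intro sum_nonpos form)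
  ultimately show ?thesis
    by linarith
qed

theorem theorem2p4:
  fixes a c a' c' :: "real \<Rightarrow> real"
  assumes a_nonneg: "\<And>t. 0 \<le> t \<Longrightarrow> 0 \<le> a t"
    and c_nonneg: "\<And>t. 0 \<le> t \<Longrightarrow> 0 \<le> c t"
    and a_deriv: "\<And>t. 0 \<le> t \<Longrightarrow> (a has_real_derivative a' t) (at t within {0..})"
    and c_deriv: "\<And>t. 0 \<le> t \<Longrightarrow> (c has_real_derivative c' t) (at t within {0..})"
    and a'_cont: "continuous_on {0..} a'"
    and c'_cont: "continuous_on {0..} c'"
  shows "(\<forall>d::nat. \<forall>f\<in>F_0_inf d. \<forall>xs. is_minimizer d f xs \<longrightarrow>
            (\<forall>x0\<in>Rn d. \<forall>X. gradient_flow d f x0 X \<longrightarrow>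
               (\<forall>t\<ge>0. \<exists>D. ((\<lambda>s. lyap d f xs (a s) (c s) (X s)) has_real_derivative D)
                             (at t within {0..}) \<and> D \<le> 0)))
     \<longleftrightarrow>
         (\<forall>t\<ge>0. \<exists>l1 l2 :: real. 0 \<le> l1 \<and> 0 \<le> l2 \<and>
            neg_semidef (vector [vector [c' t, - c t + l1 / 2],
                                 vector [- c t + l1 / 2, - a t]] :: real^2^2) \<and>
            a' t = l1 - l2)"
    (is "?decreasing \<longleftrightarrow> ?multipliers")
proof
  assume ?decreasing
  then have "lyapunov_decreasing a c"
    by (simp add: lyapunov_decreasing_def)
  with assms show ?multipliers
    by (intro allI impI lyapunov_decreasing_imp_multipliers) auto
next
  assume mult: ?multipliers
  show ?decreasing
  proof (intro allI ballI impI)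
    fix d f xs x0 X and t :: real
    assume f: "f \<in> F_0_inf d" and min: "is_minimizer d f xs"
      and flow: "gradient_flow d f x0 X" and t: "t \<ge> 0"
    \<comment> \<open>The same \<open>g\<close> gives the velocity of the trajectory and enters the
      convexity inequality at \<open>X t\<close>.\<close>
    from flow t obtain g where g: "has_gradient d f g (X t)"
      "\<And>i. i < d \<Longrightarrow> ((\<lambda>s. X s i) has_real_derivative - g i) (at t within {0..})"
      unfolding gradient_flow_def by blast
    have X_Rn: "X s \<in> Rn d" if "s \<in> {0..}" for s
      using flow that by (auto simp: gradient_flow_def)
    from mult t obtain l1 l2 where l: "0 \<le> l1" "0 \<le> l2" "a' t = l1 - l2"
      and form: "\<And>y z. c' t * y\<^sup>2 + 2 * (- c t + l1 / 2) * (y * z) + - a t * z\<^sup>2 \<le> 0"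
      unfolding neg_semidef_2_iff by blast
    show "\<exists>D. ((\<lambda>s. lyap d f xs (a s) (c s) (X s)) has_real_derivative D) (at t within {0..}) \<and> D \<le> 0"
    proof (intro exI conjI)
      show "((\<lambda>s. lyap d f xs (a s) (c s) (X s)) has_real_derivative
          a' t * (f (X t) - f xs) + (\<Sum>i<d. c' t * (X t i - xs i)\<^sup>2
            - 2 * c t * ((X t i - xs i) * g i) - a t * (g i)\<^sup>2)) (at t within {0..})"
        using t by (intro lyap_flow_derivative g X_Rn a_deriv c_deriv)
      show "a' t * (f (X t) - f xs) + (\<Sum>i<d. c' t * (X t i - xs i)\<^sup>2
            - 2 * c t * ((X t i - xs i) * g i) - a t * (g i)\<^sup>2) \<le> 0"
        unfolding l(3) using f min g(1) l(1,2) form X_Rn t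
        by (intro multipliers_imp_derivative_nonpos) auto
    qed
  qed
qed

end
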